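(* Let $\lambda\in\mathbf{C}$ with $\lambda\neq 0$, and let $D_{\rm a}$ and $\tilde D_{\rm a}$ be two anisotropy functions on $\mathbf{Z}^3$ with the same background $(\boldsymbol{\varepsilon}_0,\boldsymbol{\mu}_0)$, so that $D_{\rm a}(n)=\tilde D_{\rm a}(n)=D_0$ for all $n\in\mathbf{Z}^3\setminus\Omega$. Assume that $\lambda\notin\mathcal{E}(D_{\rm a})\cup\mathcal{E}(\tilde D_{\rm a})$. If $\Lambda(D_{\rm a})=\Lambda(\tilde D_{\rm a})$ (Dirichlet-to-Neumann operators on $\Omega$ at the parameter $\lambda$), then $D_{\rm a}=\tilde D_{\rm a}$.
   Context: **Paving.** Let $R_1,R_2,R_3\ge 1$ be integers, $[[a,b]]=\{a,a+1,\dots,b\}$, and $\Omega=[[1,R_1]]\times[[1,R_2]]\times[[1,R_3]]\subset\mathbf{Z}^3$. Let $(e_1,e_2,e_3)$ be the standard basis. For $k\in\{1,2,3\}$ put $\partial\Omega_k^+=\{n\in\mathbf{Z}^3: n_k=R_k+1,\ n_j\in[[1,R_j]]\ \forall j\ne k\}$, $\partial\Omega_k^-=\{n\in\mathbf{Z}^3: n_k=0,\ n_j\in[[1,R_j]]\ \forall j\neq k\}$, $\partial\Omega_k=\partial\Omega_k^+\cup\partial\Omega_k^-$, and $\partial\Omega=\partial\Omega_1\cup\partial\Omega_2\cup\partial\Omega_3$. For $n\in\partial\Omega$ there is exactly one $m_\Omega(n)\in\Omega$ with $|n-m_\Omega(n)|=1$; put $\nu(n)=n-m_\Omega(n)\in\{\pm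 e_1,\pm e_2,\pm e_3\}$. **Discrete Maxwell operator.** $D_j u(n)=u(n+e_j)-u(n-e_j)$. For $v=(v_1,v_2,v_3)$, $Mv=(2i)^{-1}(-D_3v_2+D_2v_3,\ D_3v_1-D_1v_3,\ -D_2v_1+D_1v_2)$. For $u=(u^E,u^H)$ with $u^E,u^H$ having values in $\mathbf{C}^3$, $H_0u=(Mu^H,-Mu^E)$. **Anisotropy.** An anisotropy function with background $(\boldsymbol{\varepsilon}_0,\boldsymbol{\mu}_0)$, where $\boldsymbol{\varepsilon}_0,\boldsymbol{\mu}_0$ are constant $3\times3$ diagonal matrices with positive diagonal entries, is a function $D_{\rm a}$ assigning to each $n\in\mathbf{Z}^3$ a real $6\times6$ diagonal matrix with positive diagonal entries, $D_{\rm a}(n)=\mathrm{diag}(\boldsymbol{\varepsilon}_p(n),\boldsymbol{\mu}_p(n))$ (block diagonal with $3\times 3$ diagonal blocks), with $D_{\rm a}(n)=D_0:=\mathrm{diag}(\boldsymbol{\varepsilon}_0,\boldsymbol{\mu}_0)$ for $n\notin\Omega$. The anisotropic operator is $H^{D_{\rm a}}=D_{\rm a}H_0$. **Function spaces.** $\mathcal{H}(\Omega;\mathbf{C}^6)$ is the space of $u=(u^E,u^H)$, $u^{E}=(u^E_1,u^E_2,u^E_3)$, $u^H=(u^H_1,u^H_2,u^H_3)$, where $u^E_j,u^H_j$ are complex-valued functions on $\Omega\cup\bigcup_{k\ne j}\partial\Omega_k$. (The equations below in $\Omega$ only involve these values.) $\mathcal{H}_{\partial\Omega,{\rm adm}}=\{f:\partial\Omega\to\mathbf{C}^3:\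 f(n)\cdot\nu(n)=0\ \forall n\in\partial\Omega\}$. For $u\in\mathcal{H}(\Omega;\mathbf{C}^6)$, $w\in\{u^E,u^H\}$ and $n\in\partial\Omega$, put $w_{\rm tan}(n)=w(n)-(w(n)\cdot\nu(n))\nu(n)$ and $\partial_{\rm tan}w(n)=(w(n)-w(m_\Omega(n)))\wedge\nu(n)$ (cross product); both do not involve the component of $w(n)$ along $\nu(n)$. Put $u_{\rm tan}=(u^E_{\rm tan},u^H_{\rm tan})$, $\partial_{\rm tan}u=(\partial_{\rm tan}u^E,\partial_{\rm tan}u^H)$, both in $(\mathcal{H}_{\partial\Omega,{\rm adm}})^2$. **Dirichlet-to-Neumann operator.** Consider, for $f\in(\mathcal{H}_{\partial\Omega,{\rm adm}})^2$ and $u\in\mathcal{H}(\Omega;\mathbf{C}^6)$, the square linear system $H^{D_{\rm a}}u-\lambda u=0$ in $\Omega$, $u_{\rm tan}=f$ on $\partial\Omega$. $\mathcal{E}(D_{\rm a})$ is the finite set of eigenvalues, i.e. the $\lambda\in\mathbf{C}$ for which the system with $f=0$ has a nonzero solution. For $\lambda\notin\mathcal{E}(D_{\rm a})$ the system has a unique solution $u$ for each $f$, and $\Lambda(D_{\rm a}):(\mathcal{H}_{\partial\Omega,{\rm adm}})^2\to(\mathcal{H}_{\partial\Omega,{\rm adm}})^2$ is $f\mapsto\partial_{\rm tan}u$. *)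

theory Defs
  imports "HOL-Analysis.Analysis"
begin

definition evec :: "3 \<Rightarrow> int ^ 3" where
  "evec k = axis k 1"

definition Omega :: "int ^ 3 \<Rightarrow> (int ^ 3) set" where
  "Omega R = {n. \<forall>k. n $ k \<in> {1..R $ k}}"

definition bdry_plus :: "int ^ 3 \<Rightarrow> 3 \<Rightarrow> (int ^ 3) set" where
  "bdry_plus R k = {n. n $ k = R $ k + 1 \<and> (\<forall>j. j \<noteq> k \<longrightarrow> n $ j \<in> {1..R $ j})}"

definition bdry_minus :: "int ^ 3 \<Rightarrow> 3 \<Rightarrow> (int ^ 3) set" where
  "bdry_minus R k = {n. n $ k = 0 \<and> (\<forall>j. j \<noteq> k \<longrightarrow> n $ j \<in> {1..R $ j})}"

definition bdry_dir :: "int ^ 3 \<Rightarrow> 3 \<Rightarrow> (int ^ 3) set" where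
  "bdry_dir R k = bdry_plus R k \<union> bdry_minus R k"

definition bdry :: "int ^ 3 \<Rightarrow> (int ^ 3) set" where
  "bdry R = (\<Union>k. bdry_dir R k)"

definition euclid_norm :: "int ^ 3 \<Rightarrow> real" where
  "euclid_norm n = norm (\<chi> j. real_of_int (n $ j))"

text \<open>The inner neighbour is unique, hence well defined, for boundary points only.\<close>

definition m_Omega :: "int ^ 3 \<Rightarrow> int ^ 3 \<Rightarrow> int ^ 3" where
  "m_Omega R n = (THE m. m \<in> Omega R \<and> euclid_norm (n - m) = 1)"

definition nu :: "int ^ 3 \<Rightarrow> int ^ 3 \<Rightarrow> complex ^ 3" where
  "nu R n = (\<chi> j. of_int ((n - m_Omega R n) $ j))"

text \<open>Complex bilinear, without conjugation; it is only ever applied with the real vector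
  \<^term>\<open>nu R n\<close> as second argument.\<close>

definition cdot :: "complex ^ 3 \<Rightarrow> complex ^ 3 \<Rightarrow> complex" where
  "cdot a b = (\<Sum>j\<in>UNIV. a $ j * b $ j)"

text \<open>The library's \<^const>\<open>cross3\<close> is restricted to real vectors.\<close>

definition ccross :: "complex ^ 3 \<Rightarrow> complex ^ 3 \<Rightarrow> complex ^ 3" where
  "ccross a b = vector [a $ 2 * b $ 3 - a $ 3 * b $ 2,
                        a $ 3 * b $ 1 - a $ 1 * b $ 3,
                        a $ 1 * b $ 2 - a $ 2 * b $ 1]"

definition Ddiff :: "3 \<Rightarrow> (int ^ 3 \<Rightarrow> complex) \<Rightarrow> int ^ 3 \<Rightarrow> complex" where
  "Ddiff j u n = u (n + evec j) - u (n - evec j)"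

definition Mop :: "(int ^ 3 \<Rightarrow> complex ^ 3) \<Rightarrow> int ^ 3 \<Rightarrow> complex ^ 3" where
  "Mop v n = inverse (2 * \<i>) *s
     vector [- Ddiff 3 (\<lambda>x. v x $ 2) n + Ddiff 2 (\<lambda>x. v x $ 3) n,
             Ddiff 3 (\<lambda>x. v x $ 1) n - Ddiff 1 (\<lambda>x. v x $ 3) n,
             - Ddiff 2 (\<lambda>x. v x $ 1) n + Ddiff 1 (\<lambda>x. v x $ 2) n]"

text \<open>Six-component objects are indexed by the sum type \<open>3 + 3\<close>: the left summand carries
  the electric components, the right summand the magnetic ones.\<close>

definition E_part :: "(int ^ 3 \<Rightarrow> complex ^ (3 + 3)) \<Rightarrow> int ^ 3 \<Rightarrow> complex ^ 3" where
  "E_part u n = (\<chi> j. u n $ Inl j)"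

definition H_part :: "(int ^ 3 \<Rightarrow> complex ^ (3 + 3)) \<Rightarrow> int ^ 3 \<Rightarrow> complex ^ 3" where
  "H_part u n = (\<chi> j. u n $ Inr j)"

definition join6 :: "complex ^ 3 \<Rightarrow> complex ^ 3 \<Rightarrow> complex ^ (3 + 3)" where
  "join6 v w = (\<chi> i. case i of Inl j \<Rightarrow> v $ j | Inr j \<Rightarrow> w $ j)"

definition H0 :: "(int ^ 3 \<Rightarrow> complex ^ (3 + 3)) \<Rightarrow> int ^ 3 \<Rightarrow> complex ^ (3 + 3)" where
  "H0 u n = join6 (Mop (H_part u) n) (- Mop (E_part u) n)"

definition pos_diagonal :: "real ^ 'n ^ 'n \<Rightarrow> bool" where
  "pos_diagonal A \<longleftrightarrow> (\<forall>i j. i \<noteq> j \<longrightarrow> A $ i $ j = 0) \<and> (\<forall>i. A $ i $ i > 0)"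

definition block_diag :: "real ^ 3 ^ 3 \<Rightarrow> real ^ 3 ^ 3 \<Rightarrow> real ^ (3 + 3) ^ (3 + 3)" where
  "block_diag A B = (\<chi> i j. case (i, j) of
       (Inl a, Inl b) \<Rightarrow> A $ a $ b
     | (Inr a, Inr b) \<Rightarrow> B $ a $ b
     | _ \<Rightarrow> 0)"

text \<open>A diagonal matrix over the index type \<open>3 + 3\<close> is automatically block diagonal with
  diagonal blocks.\<close>

definition anisotropy ::
  "int ^ 3 \<Rightarrow> real ^ 3 ^ 3 \<Rightarrow> real ^ 3 ^ 3 \<Rightarrow> (int ^ 3 \<Rightarrow> real ^ (3 + 3) ^ (3 + 3)) \<Rightarrow> bool" where
  "anisotropy R eps0 mu0 Da \<longleftrightarrow>
     pos_diagonal eps0 \<and> pos_diagonal mu0 \<and>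
     (\<forall>n. pos_diagonal (Da n)) \<and>
     (\<forall>n. n \<notin> Omega R \<longrightarrow> Da n = block_diag eps0 mu0)"

definition HD ::
  "(int ^ 3 \<Rightarrow> real ^ (3 + 3) ^ (3 + 3)) \<Rightarrow> (int ^ 3 \<Rightarrow> complex ^ (3 + 3)) \<Rightarrow>
   int ^ 3 \<Rightarrow> complex ^ (3 + 3)" where
  "HD Da u n = (\<chi> i j. complex_of_real (Da n $ i $ j)) *v H0 u n"

text \<open>Functions on a subset of the lattice are represented by total functions that vanish off
  that subset.  In \<open>HOmega\<close> the subset depends on the component.\<close>

definition comp_dom :: "int ^ 3 \<Rightarrow> 3 \<Rightarrow> (int ^ 3) set" where
  "comp_dom R j = Omega R \<union> (\<Union>k\<in>{k. k \<noteq> j}. bdry_dir R k)"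

definition HOmega :: "int ^ 3 \<Rightarrow> (int ^ 3 \<Rightarrow> complex ^ (3 + 3)) set" where
  "HOmega R = {u. \<forall>j n. n \<notin> comp_dom R j \<longrightarrow> E_part u n $ j = 0 \<and> H_part u n $ j = 0}"

definition Hadm :: "int ^ 3 \<Rightarrow> (int ^ 3 \<Rightarrow> complex ^ 3) set" where
  "Hadm R = {f. (\<forall>n. n \<notin> bdry R \<longrightarrow> f n = 0) \<and> (\<forall>n\<in>bdry R. cdot (f n) (nu R n) = 0)}"

definition tan_part :: "int ^ 3 \<Rightarrow> (int ^ 3 \<Rightarrow> complex ^ 3) \<Rightarrow> int ^ 3 \<Rightarrow> complex ^ 3" where
  "tan_part R w n =
     (if n \<in> bdry R then w n - cdot (w n) (nu R n) *s nu R n else 0)"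

definition tan_deriv :: "int ^ 3 \<Rightarrow> (int ^ 3 \<Rightarrow> complex ^ 3) \<Rightarrow> int ^ 3 \<Rightarrow> complex ^ 3" where
  "tan_deriv R w n =
     (if n \<in> bdry R then ccross (w n - w (m_Omega R n)) (nu R n) else 0)"

definition solves ::
  "int ^ 3 \<Rightarrow> (int ^ 3 \<Rightarrow> real ^ (3 + 3) ^ (3 + 3)) \<Rightarrow> complex \<Rightarrow>
   (int ^ 3 \<Rightarrow> complex ^ 3) \<times> (int ^ 3 \<Rightarrow> complex ^ 3) \<Rightarrow>
   (int ^ 3 \<Rightarrow> complex ^ (3 + 3)) \<Rightarrow> bool" where
  "solves R Da lam f u \<longleftrightarrow>
     u \<in> HOmega R \<and>
     (\<forall>n\<in>Omega R. HD Da u n - lam *s u n = 0) \<and>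
     (tan_part R (E_part u), tan_part R (H_part u)) = f"

definition eigenvalues ::
  "int ^ 3 \<Rightarrow> (int ^ 3 \<Rightarrow> real ^ (3 + 3) ^ (3 + 3)) \<Rightarrow> complex set" where
  "eigenvalues R Da = {lam. \<exists>u. u \<noteq> (\<lambda>n. 0) \<and> solves R Da lam (\<lambda>n. 0, \<lambda>n. 0) u}"

text \<open>The description is well defined only if \<open>lam\<close> is not an eigenvalue.\<close>

definition DtN ::
  "int ^ 3 \<Rightarrow> (int ^ 3 \<Rightarrow> real ^ (3 + 3) ^ (3 + 3)) \<Rightarrow> complex \<Rightarrow>
   (int ^ 3 \<Rightarrow> complex ^ 3) \<times> (int ^ 3 \<Rightarrow> complex ^ 3) \<Rightarrow>
   (int ^ 3 \<Rightarrow> complex ^ 3) \<times> (int ^ 3 \<Rightarrow> complex ^ 3)" where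
  "DtN R Da lam = (\<lambda>f\<in>Hadm R \<times> Hadm R.
     let u = (THE u. solves R Da lam f u)
     in (tan_deriv R (E_part u), tan_deriv R (H_part u)))"

end

theory Submission
  imports Defs "HOL-Library.Function_Algebras"
begin

text \<open>
  Write the equation as \<open>H\<^sub>0 u = \<lambda> D\<^sup>-\<^sup>1 u\<close>, so that the inverse \<open>D\<^sup>-\<^sup>1\<close> of the medium plays the part of a
  potential.  The operator \<open>H\<^sub>0\<close> is symmetric for the bilinear form that has opposite signs on the
  electric and on the magnetic components.  If the two Dirichlet-to-Neumann operators agree, every
  solution \<open>u\<close> for \<open>D\<close> shares its Cauchy data with a solution \<open>v\<close> for \<open>D'\<close>.  Green's identity for
  \<open>u - v\<close> and an arbitrary solution \<open>w\<close> for \<open>D'\<close> then has no boundary terms and reduces to the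
  orthogonality relation (lemma \<open>DtN_orthogonality\<close>)

  \<open>\<Sum>\<^sub>n \<Sum>\<^sub>i \<plusminus> (1/D\<^sub>i(n) - 1/D'\<^sub>i(n)) u\<^sub>i(n) w\<^sub>i(n) = 0\<close>.

  It remains to find \<open>u\<close> and \<open>w\<close> whose product isolates one component at one point \<open>n0\<close>.

  The equation can be solved by marching along an axis.  Consider the half-space of the points that are
  not below \<open>n0\<close> in the third coordinate, and march along an axis \<open>a \<noteq> 3\<close>, starting from zero on one
  side of \<open>n0\<close>.  On the bottom layer of this half-space, the equations that contain a difference along
  axis 3 involve the layer below it, which is not yet determined.  They are no constraint, and therefore
  the components along \<open>a\<close> and along axis 3 can be chosen freely on the bottom layer; take a single unit
  at \<open>n0\<close>.  The equations skipped on the bottom layer then serve to continue the field downwards, which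
  gives a solution on the whole lattice.  A disturbance climbs by at most one layer per step of the
  march, so that in the half-space this solution lives in the cone \<open>n\<^sub>3 - n0\<^sub>3 \<le> n\<^sub>a - n0\<^sub>a\<close>
  (lemma \<open>cone_solution\<close>).  Marching from the other side gives a solution in the mirror image of this
  cone.  The two cones meet only in the edge \<open>n\<^sub>3 = n0\<^sub>3\<close>, \<open>n\<^sub>a = n0\<^sub>a\<close>, and there only the unit at \<open>n0\<close>
  is left.

  Take \<open>u\<close> for \<open>D\<close> in the first cone and \<open>w\<close> for \<open>D'\<close> in the second one.  What these solutions do below
  the half-space does not matter if the media are already known to agree there, and so induction on
  the third coordinate concludes.  The choices \<open>a = 1\<close> and \<open>a = 2\<close> together reach every component.
\<close>

section \<open>Fields that spread in a cone\<close>

text \<open>The system in local coordinates.  Both fields are written as one family indexed by a Boolean, the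
  field with index \<open>s\<close> being driven by the curl of the field with index \<open>\<not> s\<close>; the coefficients \<open>p1\<close>,
  \<open>p2\<close>, \<open>p3\<close> absorb the spectral parameter, the medium and the sign that distinguishes electric
  from magnetic equations.  The seeds \<open>c1\<close> and \<open>c3\<close> are the values at the origin.\<close>

locale cone_march =
  fixes p1 p2 p3 :: "bool \<Rightarrow> int \<Rightarrow> int \<Rightarrow> int \<Rightarrow> complex" and c1 c3 :: "bool \<Rightarrow> complex"
  assumes p1: "p1 s x y z \<noteq> 0" and p3: "p3 s x y z \<noteq> 0"
begin

text \<open>The field is constructed by two marches.

  For \<open>z \<ge> 0\<close> it vanishes when \<open>x < 0\<close> and is continued in the direction of growing \<open>x\<close>: the third
  equation at \<open>x - 1\<close> gives \<open>F2\<close> at \<open>x\<close>, the second equation at \<open>x - 1\<close> gives \<open>F3\<close> at \<open>x\<close>, and the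
  first equation at \<open>x\<close>, which contains no difference in \<open>x\<close>, gives \<open>F1\<close> there.  On the layer \<open>z = 0\<close>
  the first and the second equation contain values on the layer \<open>z = -1\<close>, which are still
  undetermined.  They do not restrict this march, so that \<open>F1\<close> and \<open>F3\<close> can be prescribed on the
  layer \<open>z = 0\<close>: this is the source of a nonzero field.

  For \<open>z < 0\<close> the field is continued downwards: the first and second equation at \<open>z + 1\<close> give \<open>F2\<close>
  and \<open>F1\<close> at \<open>z\<close>, and then the third equation at \<open>z\<close> gives \<open>F3\<close>.\<close>

function (sequential)
  F1 and F2 and F3 :: "bool \<Rightarrow> int \<Rightarrow> int \<Rightarrow> int \<Rightarrow> complex" where
  "F1 s x y z =
     (if z < 0 then F1 s x y (z + 2) - (F3 s (x + 1) y (z + 1) - F3 s (x - 1) y (z + 1))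
        - p2 (\<not> s) x y (z + 1) * F2 (\<not> s) x y (z + 1)
      else if x < 0 then 0
      else if z = 0 then (if x = 0 \<and> y = 0 then c1 s else 0)
      else (F3 (\<not> s) x (y + 1) z - F3 (\<not> s) x (y - 1) z
        - (F2 (\<not> s) x y (z + 1) - F2 (\<not> s) x y (z - 1))) / p1 s x y z)"
| "F2 s x y z =
     (if z < 0 then F2 s x y (z + 2) - (F3 s x (y + 1) (z + 1) - F3 s x (y - 1) (z + 1))
        + p1 (\<not> s) x y (z + 1) * F1 (\<not> s) x y (z + 1)
      else if x \<le> 0 then 0
      else F2 s (x - 2) y z + (F1 s (x - 1) (y + 1) z - F1 s (x - 1) (y - 1) z)
        + p3 (\<not> s) (x - 1) y z * F3 (\<not> s) (x - 1) y z)"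
| "F3 s x y z =
     (if z < 0 then (F2 (\<not> s) (x + 1) y z - F2 (\<not> s) (x - 1) y z
        - (F1 (\<not> s) x (y + 1) z - F1 (\<not> s) x (y - 1) z)) / p3 s x y z
      else if x < 0 then 0
      else if z = 0 then (if x = 0 \<and> y = 0 then c3 s else 0)
      else F3 s (x - 2) y z + (F1 s (x - 1) y (z + 1) - F1 s (x - 1) y (z - 1))
        - p2 (\<not> s) (x - 1) y z * F2 (\<not> s) (x - 1) y z)"
  by pat_completeness auto

text \<open>The recursion first climbs to a layer \<open>z \<ge> 0\<close> and then lowers \<open>x\<close>.  The second measure breaks the
  ties: \<open>F1\<close> comes after \<open>F2\<close> and \<open>F3\<close> at the same \<open>x\<close> when \<open>z \<ge> 0\<close>, and \<open>F3\<close> comes last in its layer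
  when \<open>z < 0\<close>.\<close>

termination
  by (relation "measures
      [\<lambda>q. case q of Inl (_,x,y,z) \<Rightarrow> nat (- z)
        | Inr (Inl (_,x,y,z)) \<Rightarrow> nat (- z) | Inr (Inr (_,x,y,z)) \<Rightarrow> nat (- z),
       \<lambda>q. case q of Inl (_,x,y,z) \<Rightarrow> if z < 0 then 0 else 2 * nat (x + 1) + 1
        | Inr (Inl (_,x,y,z)) \<Rightarrow> if z < 0 then 0 else 2 * nat (x + 1)
        | Inr (Inr (_,x,y,z)) \<Rightarrow> if z < 0 then 1 else 2 * nat (x + 1)]") auto

declare F1.simps [simp del] F2.simps [simp del] F3.simps [simp del]

lemma F2_negative: "z \<ge> 0 \<Longrightarrow> x \<le> 0 \<Longrightarrow> F2 s x y z = 0"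
  by (subst F2.simps) simp

lemma F3_negative: "z \<ge> 0 \<Longrightarrow> x < 0 \<Longrightarrow> F3 s x y z = 0"
  by (subst F3.simps) simp

lemma F1_negative: "z \<ge> 0 \<Longrightarrow> x < 0 \<Longrightarrow> F1 s x y z = 0"
  by (subst F1.simps) simp

text \<open>The march moves information by at most one step in \<open>z\<close> per step in \<open>x\<close>, so the field stays in a cone
  of slope one.  The component \<open>F2\<close> must vanish on the face of the cone as well, because \<open>F1\<close> at
  \<open>(x, z)\<close> depends on \<open>F2\<close> at \<open>(x, z - 1)\<close>.\<close>

lemma support_induct:
  "z \<ge> 0 \<Longrightarrow> (x < z \<longrightarrow> F1 s x y z = 0 \<and> F3 s x y z = 0) \<and> (x \<le> z \<longrightarrow> F2 s x y z = 0)"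
proof (induction "nat (x + 1)" arbitrary: s x y z rule: less_induct)
  case less
  show ?case
  proof (cases "x < 0")
    case True
    then show ?thesis using less.prems F1_negative F2_negative F3_negative by auto
  next
    case False
    have IH: "F1 s' x' y' z' = 0" "F3 s' x' y' z' = 0"
      if "x' < x" "z' \<ge> 0" "x' < z'" for s' x' y' z'
      using less.hyps[of x' z' s' y'] that False by auto
    have IH2: "F2 s' x' y' z' = 0" if "x' < x" "z' \<ge> 0" "x' \<le> z'" for s' x' y' z'
      using less.hyps[of x' z' s' y'] that False by auto
    have 2: "F2 s' x y' z' = 0" if "x \<le> z'" "z' \<ge> 0" for s' y' z'
      using that by (subst F2.simps) (auto simp: IH IH2)
    have 3: "F3 s' x y' z' = 0" if "x < z'" "z' \<ge> 0" for s' y' z'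
      using that by (subst F3.simps) (auto simp: IH IH2)
    have 1: "F1 s x y z = 0" if "x < z"
      using that less.prems False by (subst F1.simps) (auto simp: 2 3)
    show ?thesis using 1 2 3 less.prems by auto
  qed
qed

lemma support:
  assumes "z \<ge> 0"
  shows "x < z \<Longrightarrow> F1 s x y z = 0" "x \<le> z \<Longrightarrow> F2 s x y z = 0" "x < z \<Longrightarrow> F3 s x y z = 0"
  using support_induct[OF assms] by auto

lemma seed:
  "F1 s 0 y 0 = (if y = 0 then c1 s else 0)" "F2 s 0 y 0 = 0"
  "F3 s 0 y 0 = (if y = 0 then c3 s else 0)"
  by (simp_all add: F1.simps[of s 0] F2.simps[of s 0] F3.simps[of s 0])

lemma equation1:
  "p1 s x y z * F1 s x y z =
     (F3 (\<not> s) x (y + 1) z - F3 (\<not> s) x (y - 1) z) - (F2 (\<not> s) x y (z + 1) - F2 (\<not> s) x y (z - 1))"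
proof -
  consider "z \<le> 0" | "z > 0" "x < 0" | "z > 0" "x \<ge> 0" by linarith
  then show ?thesis
  proof cases
    case 1
    then show ?thesis by (simp add: F2.simps[of "\<not> s" x y "z - 1"] algebra_simps)
  next
    case 2
    then show ?thesis by (simp add: F1_negative F2_negative F3_negative)
  next
    case 3
    then show ?thesis by (simp add: F1.simps[of s x y z] p1)
  qed
qed

lemma equation2:
  "p2 s x y z * F2 s x y z =
     (F1 (\<not> s) x y (z + 1) - F1 (\<not> s) x y (z - 1)) - (F3 (\<not> s) (x + 1) y z - F3 (\<not> s) (x - 1) y z)"
proof -
  consider "z \<le> 0" | "z > 0" "x < - 1" | "z > 0" "x \<ge> - 1" by linarith
  then show ?thesis
  proof cases
    case 1
    then show ?thesis by (simp add: F1.simps[of "\<not> s" x y "z - 1"] algebra_simps)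
  next
    case 2
    then show ?thesis by (simp add: F1_negative F2_negative F3_negative)
  next
    case 3
    then show ?thesis using F3.simps[of "\<not> s" "x + 1" y z] by (simp add: diff_add_eq)
  qed
qed

lemma equation3:
  "p3 s x y z * F3 s x y z =
     (F2 (\<not> s) (x + 1) y z - F2 (\<not> s) (x - 1) y z) - (F1 (\<not> s) x (y + 1) z - F1 (\<not> s) x (y - 1) z)"
proof -
  consider "z < 0" | "z \<ge> 0" "x < 0" | "z \<ge> 0" "x \<ge> 0" by linarith
  then show ?thesis
  proof cases
    case 1
    then show ?thesis by (simp add: F3.simps[of s x y z] p3)
  next
    case 2
    then show ?thesis by (simp add: F1_negative F2_negative F3_negative)
  next
    case 3
    then show ?thesis using F2.simps[of "\<not> s" "x + 1" y z] by (simp add: diff_add_eq)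
  qed
qed

end

section \<open>Cone-supported solutions of the Maxwell equation\<close>

text \<open>Exchanging the first two axes reverses the sign of the curl; \<open>s\<close> is that sign.\<close>

definition oriented :: "3 \<Rightarrow> 3 \<Rightarrow> 3 \<Rightarrow> complex \<Rightarrow> bool" where
  "oriented a b c s \<longleftrightarrow> (a, b, c, s) \<in> {(1, 2, 3, 1), (2, 1, 3, - 1)}"

lemma oriented_distinct:
  assumes "oriented a b c s"
  shows "a \<noteq> b" "b \<noteq> a" "a \<noteq> c" "c \<noteq> a" "b \<noteq> c" "c \<noteq> b" "s * s = 1" "j = a \<or> j = b \<or> j = c"
  using assms exhaust_3[of j] by (auto simp: oriented_def)

lemma Mop_oriented:
  assumes "oriented a b c s"
  shows "Mop v n $ a = inverse (2 * \<i>) * (s * (Ddiff b (\<lambda>x. v x $ c) n - Ddiff c (\<lambda>x. v x $ b) n))"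
    and "Mop v n $ b = inverse (2 * \<i>) * (s * (Ddiff c (\<lambda>x. v x $ a) n - Ddiff a (\<lambda>x. v x $ c) n))"
    and "Mop v n $ c = inverse (2 * \<i>) * (s * (Ddiff a (\<lambda>x. v x $ b) n - Ddiff b (\<lambda>x. v x $ a) n))"
  using assms by (auto simp: oriented_def Mop_def vector_def)

lemma HD_component:
  assumes "pos_diagonal (Da n)"
  shows "HD Da u n $ i = complex_of_real (Da n $ i $ i) * H0 u n $ i"
proof -
  have "HD Da u n $ i = (\<Sum>j\<in>UNIV. complex_of_real (Da n $ i $ j) * H0 u n $ j)"
    by (simp add: HD_def matrix_vector_mult_def)
  also have "\<dots> = (\<Sum>j\<in>UNIV. if j = i then complex_of_real (Da n $ i $ i) * H0 u n $ i else 0)"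
    using assms by (intro sum.cong) (auto simp: pos_diagonal_def)
  finally show ?thesis by simp
qed

lemma H0_component [simp]:
  "H0 u n $ Inl j = Mop (H_part u) n $ j" "H0 u n $ Inr j = - Mop (E_part u) n $ j"
  by (simp_all add: H0_def join6_def)

text \<open>Solutions on the whole lattice that, above the layer through \<open>n0\<close>, live in a cone opening in
  direction \<open>t\<close> of the axis \<open>a\<close>, and whose trace on the bottom edge of this cone is concentrated in one
  component at \<open>n0\<close>.  The component lies along \<open>a\<close> or \<open>c\<close>: these are the components that the march leaves
  free on the bottom layer.\<close>

lemma cone_solution:
  fixes Da :: "int ^ 3 \<Rightarrow> real ^ (3 + 3) ^ (3 + 3)" and n0 :: "int ^ 3" and t :: int
  assumes ori: "oriented a b c s" and lam: "lam \<noteq> 0"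
    and pos: "\<And>n. pos_diagonal (Da n)"
    and t: "t = 1 \<or> t = - 1"
    and j0: "j0 = a \<or> j0 = c" and i0: "i0 = Inl j0 \<or> i0 = Inr j0"
  obtains u where "\<forall>n. HD Da u n = lam *s u n"
    and "\<forall>n i. n0 $ c \<le> n $ c \<longrightarrow> u n $ i \<noteq> 0 \<longrightarrow> n $ c - n0 $ c \<le> t * (n $ a - n0 $ a)"
    and "\<forall>n i. n $ c = n0 $ c \<longrightarrow> n $ a = n0 $ a \<longrightarrow> (u n $ i \<noteq> 0 \<longleftrightarrow> n = n0 \<and> i = i0)"
proof -
  note dist = oriented_distinct(1-6)[OF ori] and ss = oriented_distinct(7)[OF ori]
    and cover = oriented_distinct(8)[OF ori]
  define lat where "lat x y z = (\<chi> j. if j = a then n0 $ a + t * x else if j = b then n0 $ b + y else n0 $ c + z)"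
    for x y z
  define X Y Z where "X n = t * (n $ a - n0 $ a)" and "Y n = n $ b - n0 $ b" and "Z n = n $ c - n0 $ c" for n
  have tt: "t * t = 1" "t * (t * k) = k" for k using t by auto
  have lat: "lat (X n) (Y n) (Z n) = n" for n
    using cover by (auto simp: lat_def X_def Y_def Z_def vec_eq_iff tt)
  have pos': "Da n $ i $ i \<noteq> 0" for n i
    using pos[of n] unfolding pos_diagonal_def by (metis less_irrefl)
  define p where "p k e x y z = (if e then 2 * \<i> * lam / of_real (Da (lat x y z) $ Inl k $ Inl k)
      else - (2 * \<i> * lam / of_real (Da (lat x y z) $ Inr k $ Inr k)))" for k :: 3 and e x y z
  interpret cone_march "p a" "p b" "p c" "\<lambda>e. of_bool (i0 = (if e then Inl a else Inr a))"
    "\<lambda>e. of_bool (i0 = (if e then Inl c else Inr c))"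
    using lam pos' by unfold_locales (auto simp: p_def)
  \<comment> \<open>A reflection of the axis \<open>a\<close> flips the normal component of the electric field and the tangential
    components of the magnetic one, as the latter is axial; the sign \<open>s\<close> is put on the magnetic field.\<close>
  define u :: "int ^ 3 \<Rightarrow> complex ^ (3 + 3)" where "u n = (\<chi> i. case i of
      Inl j \<Rightarrow> if j = a then of_int t * F1 True (X n) (Y n) (Z n)
              else if j = b then F2 True (X n) (Y n) (Z n) else F3 True (X n) (Y n) (Z n)
    | Inr j \<Rightarrow> if j = a then s * F1 False (X n) (Y n) (Z n)
              else if j = b then s * of_int t * F2 False (X n) (Y n) (Z n)
              else s * of_int t * F3 False (X n) (Y n) (Z n))" for n
  have u: "u n $ Inl a = of_int t * F1 True (X n) (Y n) (Z n)"
    "u n $ Inl b = F2 True (X n) (Y n) (Z n)"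
    "u n $ Inl c = F3 True (X n) (Y n) (Z n)"
    "u n $ Inr a = s * F1 False (X n) (Y n) (Z n)"
    "u n $ Inr b = s * of_int t * F2 False (X n) (Y n) (Z n)"
    "u n $ Inr c = s * of_int t * F3 False (X n) (Y n) (Z n)" for n
    using dist by (simp_all add: u_def)
  have shift: "X (n + evec a) = X n + t" "X (n - evec a) = X n - t"
    "Y (n + evec a) = Y n" "Y (n - evec a) = Y n" "Z (n + evec a) = Z n" "Z (n - evec a) = Z n"
    "X (n + evec b) = X n" "X (n - evec b) = X n" "Y (n + evec b) = Y n + 1" "Y (n - evec b) = Y n - 1"
    "Z (n + evec b) = Z n" "Z (n - evec b) = Z n"
    "X (n + evec c) = X n" "X (n - evec c) = X n" "Y (n + evec c) = Y n" "Y (n - evec c) = Y n"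
    "Z (n + evec c) = Z n + 1" "Z (n - evec c) = Z n - 1" for n
    using dist by (auto simp: X_def Y_def Z_def evec_def axis_def algebra_simps)
  have s: "s = 1 \<or> s = - 1"
    using ori by (auto simp: oriented_def)
  have curlE:
    "s * (Ddiff b (\<lambda>x. u x $ Inr c) n - Ddiff c (\<lambda>x. u x $ Inr b) n)
       = p a True (X n) (Y n) (Z n) * u n $ Inl a"
    "s * (Ddiff c (\<lambda>x. u x $ Inr a) n - Ddiff a (\<lambda>x. u x $ Inr c) n)
       = p b True (X n) (Y n) (Z n) * u n $ Inl b"
    "s * (Ddiff a (\<lambda>x. u x $ Inr b) n - Ddiff b (\<lambda>x. u x $ Inr a) n)
       = p c True (X n) (Y n) (Z n) * u n $ Inl c" for n
    using equation1[of True "X n" "Y n" "Z n"] equation2[of True "X n" "Y n" "Z n"]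
      equation3[of True "X n" "Y n" "Z n"] t s
    by (auto simp: u Ddiff_def shift algebra_simps)
  have curlH:
    "s * (Ddiff b (\<lambda>x. u x $ Inl c) n - Ddiff c (\<lambda>x. u x $ Inl b) n)
       = p a False (X n) (Y n) (Z n) * u n $ Inr a"
    "s * (Ddiff c (\<lambda>x. u x $ Inl a) n - Ddiff a (\<lambda>x. u x $ Inl c) n)
       = p b False (X n) (Y n) (Z n) * u n $ Inr b"
    "s * (Ddiff a (\<lambda>x. u x $ Inl b) n - Ddiff b (\<lambda>x. u x $ Inl a) n)
       = p c False (X n) (Y n) (Z n) * u n $ Inr c" for n
    using equation1[of False "X n" "Y n" "Z n"] equation2[of False "X n" "Y n" "Z n"]
      equation3[of False "X n" "Y n" "Z n"] t s
    by (auto simp: u Ddiff_def shift algebra_simps)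
  have pE: "of_real (Da n $ Inl k $ Inl k) * (inverse (2 * \<i>) * (p k True (X n) (Y n) (Z n) * w)) = lam * w"
    and pH: "of_real (Da n $ Inr k $ Inr k) * - (inverse (2 * \<i>) * (p k False (X n) (Y n) (Z n) * w)) = lam * w"
    for n k w
    using pos'[of n "Inl k"] pos'[of n "Inr k"] by (simp_all add: p_def lat field_simps)
  have MopE: "Mop (H_part u) n $ j = inverse (2 * \<i>) * (p j True (X n) (Y n) (Z n) * u n $ Inl j)"
    and MopH: "Mop (E_part u) n $ j = inverse (2 * \<i>) * (p j False (X n) (Y n) (Z n) * u n $ Inr j)" for n j
    using cover[of j] by (auto simp only: Mop_oriented[OF ori] H_part_def E_part_def vec_lambda_beta curlE curlH)
  have comp: "HD Da u n $ i = lam * u n $ i" for n i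
    by (cases i) (simp_all only: HD_component[OF pos] H0_component MopE MopH pE pH)
  show ?thesis
  proof (rule that[of u]; intro allI impI)
    show "HD Da u n = lam *s u n" for n
      by (simp add: vec_eq_iff comp)
  next
    fix n i assume "n0 $ c \<le> n $ c" "u n $ i \<noteq> 0"
    then have "\<not> X n < Z n"
      using support[of "Z n" "X n"] by (auto simp: u_def Z_def split: sum.splits if_splits)
    then show "n $ c - n0 $ c \<le> t * (n $ a - n0 $ a)"
      by (simp add: X_def Z_def)
  next
    fix n i assume n: "n $ c = n0 $ c" "n $ a = n0 $ a"
    then have "X n = 0" "Z n = 0" by (simp_all add: X_def Z_def)
    moreover have "Y n = 0 \<longleftrightarrow> n = n0"
    proof
      assume "Y n = 0"
      then have "n $ j = n0 $ j" for j
        using n cover[of j] by (auto simp: Y_def)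
      then show "n = n0"
        by (simp add: vec_eq_iff)
    qed (simp add: Y_def)
    moreover have "s \<noteq> 0" "t \<noteq> 0" using ss t by auto
    ultimately show "u n $ i \<noteq> 0 \<longleftrightarrow> n = n0 \<and> i = i0"
      using j0 i0 dist cover[of "case i of Inl j \<Rightarrow> j | Inr j \<Rightarrow> j"]
      by (cases i) (auto simp: u_def seed)
  qed
qed

section \<open>The box, its boundary and tangential traces\<close>

lemma finite_coordinate_box: "finite {n::int ^ 3. \<forall>k. n $ k \<in> {l $ k..r $ k}}"
proof -
  have "inj_on (\<lambda>n::int ^ 3. (n $ 1, n $ 2, n $ 3)) A" for A
    by (rule inj_onI) (auto simp: vec_eq_iff forall_3)
  moreover have "(\<lambda>n::int ^ 3. (n $ 1, n $ 2, n $ 3)) ` {n. \<forall>k. n $ k \<in> {l $ k..r $ k}}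
      \<subseteq> {l $ 1..r $ 1} \<times> {l $ 2..r $ 2} \<times> {l $ 3..r $ 3}"
    by auto
  ultimately show ?thesis
    by (metis (no_types, lifting) finite_SigmaI finite_atLeastAtMost_int finite_imageD finite_subset)
qed

lemma finite_Omega: "finite (Omega R)"
  unfolding Omega_def using finite_coordinate_box[of "\<chi> k. 1" R] by simp

lemma finite_comp_dom:
  assumes R: "\<forall>k. R $ k \<ge> 1"
  shows "finite (comp_dom R j)"
proof (rule finite_subset)
  have "0 \<le> n $ k \<and> n $ k \<le> R $ k + 1" if n: "n \<in> comp_dom R j" for n k
  proof -
    have Rk: "R $ k \<ge> 1" using R by blast
    consider "n \<in> Omega R" | x where "n \<in> bdry_dir R x"
      using n by (auto simp: comp_dom_def)
    then show ?thesis
    proof cases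
      case 1
      then have "n $ k \<in> {1..R $ k}" by (simp add: Omega_def)
      then show ?thesis by simp
    next
      case (2 x)
      then have "x = k \<Longrightarrow> n $ k = 0 \<or> n $ k = R $ k + 1" "x \<noteq> k \<Longrightarrow> n $ k \<in> {1..R $ k}"
        by (auto simp: bdry_dir_def bdry_plus_def bdry_minus_def)
      then show ?thesis using Rk by fastforce
    qed
  qed
  then show "comp_dom R j \<subseteq> {n. \<forall>k. n $ k \<in> {0 $ k..(\<chi> k. R $ k + 1) $ k}}"
    by auto
qed (rule finite_coordinate_box)

lemma int_vec_norm_1:
  fixes d :: "int ^ 3"
  assumes "euclid_norm d = 1" "d $ k \<ge> 1"
  shows "d = evec k"
proof -
  have "(\<Sum>j\<in>UNIV. (real_of_int (d $ j))\<^sup>2) = 1"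
    using assms(1) by (simp add: euclid_norm_def norm_vec_def L2_set_def)
  then have "real_of_int (\<Sum>j\<in>UNIV. (d $ j)\<^sup>2) = 1"
    by simp
  then have 1: "(\<Sum>j\<in>UNIV. (d $ j)\<^sup>2) = 1"
    by linarith
  have 2: "(\<Sum>j\<in>UNIV. (d $ j)\<^sup>2) = (d $ k)\<^sup>2 + (\<Sum>j\<in>UNIV - {k}. (d $ j)\<^sup>2)"
    by (simp add: sum.remove)
  have 3: "(d $ k)\<^sup>2 \<ge> d $ k" "(\<Sum>j\<in>UNIV - {k}. (d $ j)\<^sup>2) \<ge> 0"
    using assms(2) by (auto simp: power2_eq_square sum_nonneg)
  then have "d $ k = 1" "(\<Sum>j\<in>UNIV - {k}. (d $ j)\<^sup>2) = 0"
    using 1 2 assms(2) by linarith+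
  moreover from this(2) have "\<forall>j\<in>UNIV - {k}. (d $ j)\<^sup>2 = 0"
    by (subst (asm) sum_nonneg_eq_0_iff) auto
  ultimately show ?thesis
    by (auto simp: vec_eq_iff evec_def axis_def)
qed

lemma euclid_norm_simps: "euclid_norm (evec k) = 1" "euclid_norm (- n) = euclid_norm n"
proof -
  have "(\<chi> j. real_of_int (evec k $ j)) = axis k 1"
    by (simp add: vec_eq_iff evec_def axis_def)
  then show "euclid_norm (evec k) = 1" by (simp add: euclid_norm_def)
  have "(\<chi> j. real_of_int ((- n) $ j)) = - (\<chi> j. real_of_int (n $ j))"
    by (simp add: vec_eq_iff)
  then show "euclid_norm (- n) = euclid_norm n" by (simp only: euclid_norm_def norm_minus_cancel)
qed

lemma evec_component: "evec k $ j = (if j = k then 1 else 0)"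
  by (simp add: evec_def axis_def)

lemma m_Omega_plus:
  assumes R: "\<forall>k. R $ k \<ge> 1" and n: "n \<in> bdry_plus R k"
  shows "m_Omega R n = n - evec k"
  unfolding m_Omega_def
proof (rule the_equality)
  show "n - evec k \<in> Omega R \<and> euclid_norm (n - (n - evec k)) = 1"
    using R n by (auto simp: bdry_plus_def Omega_def evec_component euclid_norm_simps)
next
  fix m assume m: "m \<in> Omega R \<and> euclid_norm (n - m) = 1"
  then have "(n - m) $ k \<ge> 1"
    using n by (simp add: bdry_plus_def Omega_def)
  then have "n - m = evec k"
    using m int_vec_norm_1 by blast
  then show "m = n - evec k" by (auto simp: algebra_simps)
qed

lemma m_Omega_minus:
  assumes R: "\<forall>k. R $ k \<ge> 1" and n: "n \<in> bdry_minus R k"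
  shows "m_Omega R n = n + evec k"
  unfolding m_Omega_def
proof (rule the_equality)
  show "n + evec k \<in> Omega R \<and> euclid_norm (n - (n + evec k)) = 1"
    using R n by (auto simp: bdry_minus_def Omega_def evec_component euclid_norm_simps)
next
  fix m assume m: "m \<in> Omega R \<and> euclid_norm (n - m) = 1"
  then have "(- (n - m)) $ k \<ge> 1"
    using n by (simp add: bdry_minus_def Omega_def)
  then have "- (n - m) = evec k"
    using m int_vec_norm_1 euclid_norm_simps(2) by metis
  then show "m = n + evec k" by (auto simp: algebra_simps)
qed

lemma nu_bdry_dir:
  assumes R: "\<forall>k. R $ k \<ge> 1" and n: "n \<in> bdry_dir R k"
  shows "nu R n = axis k 1 \<or> nu R n = - axis k 1"
  using n m_Omega_plus[OF R] m_Omega_minus[OF R]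
  by (auto simp: bdry_dir_def nu_def vec_eq_iff evec_component axis_def)

lemma tan_part_component:
  assumes R: "\<forall>k. R $ k \<ge> 1" and n: "n \<in> bdry_dir R k"
  shows "tan_part R w n $ j = (if j = k then 0 else w n $ j)"
proof -
  have "n \<in> bdry R" using n by (auto simp: bdry_def)
  moreover have "cdot (w n) (nu R n) * nu R n $ j = (if j = k then w n $ k else 0)"
    using nu_bdry_dir[OF R n] by (auto simp: cdot_def axis_def if_distrib cong: if_cong)
  ultimately show ?thesis by (auto simp: tan_part_def)
qed

text \<open>The cross product with the normal annihilates only the normal component, so equal tangential
  derivatives and boundary values give equal tangential components at the inner neighbour.\<close>

lemma tan_deriv_eq_imp:
  assumes R: "\<forall>k. R $ k \<ge> 1" and n: "n \<in> bdry_dir R k"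
    and eq: "tan_deriv R v n = tan_deriv R w n" "tan_part R v n = tan_part R w n" and j: "j \<noteq> k"
  shows "v (m_Omega R n) $ j = w (m_Omega R n) $ j"
proof -
  have nb: "n \<in> bdry R" using n by (auto simp: bdry_def)
  have vw: "v n $ j = w n $ j" if "j \<noteq> k" for j
    using eq(2) tan_part_component[OF R n] that by (metis (full_types))
  have "ccross (v n - v (m_Omega R n)) (nu R n) = ccross (w n - w (m_Omega R n)) (nu R n)"
    using eq(1) nb by (simp add: tan_deriv_def)
  then show ?thesis
    using nu_bdry_dir[OF R n] vw[of 1] vw[of 2] vw[of 3] j exhaust_3[of k] exhaust_3[of j]
    by (auto simp: ccross_def vec_eq_iff forall_3 axis_def vector_def)
qed

lemma tan_part_Hadm:
  assumes R: "\<forall>k. R $ k \<ge> 1"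
  shows "tan_part R w \<in> Hadm R"
proof -
  have "cdot (tan_part R w n) (nu R n) = 0" if "n \<in> bdry R" for n
  proof -
    obtain k where "n \<in> bdry_dir R k" using \<open>n \<in> bdry R\<close> unfolding bdry_def by blast
    then show ?thesis
      using nu_bdry_dir[OF R, of n k] tan_part_component[OF R, of n k w]
      by (auto simp: cdot_def axis_def intro!: sum.neutral)
  qed
  then show ?thesis by (auto simp: Hadm_def tan_part_def)
qed

lemma bdry_dir_notin_Omega:
  assumes R: "\<forall>k. R $ k \<ge> 1"
  shows "n \<in> bdry_dir R k \<Longrightarrow> n \<notin> Omega R"
  using R by (auto simp: Omega_def bdry_dir_def bdry_plus_def bdry_minus_def intro!: exI[of _ k])

text \<open>A boundary point of \<open>\<partial>\<Omega>\<^sub>k\<close> is in the domain of the components other than the \<open>k\<close>-th, which are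
  the tangential ones there; so tangential parts carry all exterior values of the fields in
  \<^const>\<open>HOmega\<close>.\<close>

lemma tan_part_eq_iff:
  assumes R: "\<forall>k. R $ k \<ge> 1"
    and v: "\<And>n j. n \<notin> comp_dom R j \<Longrightarrow> v n $ j = 0"
    and w: "\<And>n j. n \<notin> comp_dom R j \<Longrightarrow> w n $ j = 0"
  shows "tan_part R v = tan_part R w \<longleftrightarrow> (\<forall>n. n \<notin> Omega R \<longrightarrow> v n = w n)"
proof
  assume eq: "tan_part R v = tan_part R w"
  have "v n $ j = w n $ j" if off: "n \<notin> Omega R" for n j
  proof (cases "n \<in> comp_dom R j")
    case True
    then obtain k where "k \<noteq> j" "n \<in> bdry_dir R k"
      using off unfolding comp_dom_def by blast
    then show ?thesis
      using eq tan_part_component[OF R, of n k] by metis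
  qed (simp add: v w)
  then show "\<forall>n. n \<notin> Omega R \<longrightarrow> v n = w n" by (simp add: vec_eq_iff)
next
  assume "\<forall>n. n \<notin> Omega R \<longrightarrow> v n = w n"
  moreover have "n \<notin> Omega R" if "n \<in> bdry R" for n
    using that bdry_dir_notin_Omega[OF R] unfolding bdry_def by blast
  ultimately show "tan_part R v = tan_part R w"
    by (auto simp: tan_part_def)
qed

section \<open>Solvability of the Dirichlet problem\<close>

text \<open>The functions supported in \<open>I\<close> form a finite-dimensional space that \<open>T\<close> maps into itself: the
  image of a basis is independent and has full cardinality, so it spans.\<close>

lemma injective_on_finite_support_imp_surjective:
  fixes T :: "('a \<Rightarrow> 'b::field) \<Rightarrow> 'a \<Rightarrow> 'b"
  assumes fin: "finite I"
    and add: "\<And>f g. T (\<lambda>x. f x + g x) = (\<lambda>x. T f x + T g x)"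
    and scale: "\<And>c f. T (\<lambda>x. c * f x) = (\<lambda>x. c * T f x)"
    and supp: "\<And>f x. (\<And>y. y \<notin> I \<Longrightarrow> f y = 0) \<Longrightarrow> x \<notin> I \<Longrightarrow> T f x = 0"
    and inj: "\<And>f. (\<And>y. y \<notin> I \<Longrightarrow> f y = 0) \<Longrightarrow> T f = (\<lambda>x. 0) \<Longrightarrow> f = (\<lambda>x. 0)"
    and g: "\<And>x. x \<notin> I \<Longrightarrow> g x = 0"
  obtains f where "\<forall>x. x \<notin> I \<longrightarrow> f x = 0" "T f = g"
proof -
  interpret V: vector_space "\<lambda>(c::'b) (f::'a \<Rightarrow> 'b) x. c * f x"
    by unfold_locales (auto simp: fun_eq_iff algebra_simps)
  interpret T: Vector_Spaces.linear "\<lambda>(c::'b) (f::'a \<Rightarrow> 'b) x. c * f x"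
      "\<lambda>(c::'b) (f::'a \<Rightarrow> 'b) x. c * f x" T
    by unfold_locales (auto simp: plus_fun_def add scale)
  define W where "W = {f::'a \<Rightarrow> 'b. \<forall>x. x \<notin> I \<longrightarrow> f x = 0}"
  have subW: "V.subspace W"
    by (auto simp: V.subspace_def W_def)
  define e where "e = (\<lambda>(i::'a) x. if x = i then 1 else (0::'b))"
  have W_span: "W \<subseteq> V.span (e ` I)"
  proof
    fix f assume "f \<in> W"
    have apply_sum: "(\<Sum>i\<in>J. h i) x = (\<Sum>i\<in>J. h i x)" for J and h :: "'a \<Rightarrow> 'a \<Rightarrow> 'b" and x
      by (induction J rule: infinite_finite_induct) auto
    have "f = (\<Sum>i\<in>I. (\<lambda>x. f i * e i x))"
      using fin \<open>f \<in> W\<close>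
      by (auto simp: fun_eq_iff e_def W_def apply_sum if_distrib cong: if_cong)
    also have "\<dots> \<in> V.span (e ` I)"
      by (intro V.span_sum V.span_scale V.span_base imageI)
    finally show "f \<in> V.span (e ` I)" .
  qed
  obtain B where B0: "B \<subseteq> W" "V.independent B" "W \<subseteq> V.span B"
    by (rule V.basis_exists)
  have spanB: "V.span B = W"
    using V.span_minimal[OF B0(1) subW] B0(3) by (rule subset_antisym)
  note B = B0(1,2) spanB
  have finB: "finite B"
    using V.independent_span_bound[OF finite_imageI[OF fin] B(2)] B(1) W_span by blast
  have injB: "inj_on T W"
  proof (rule inj_onI)
    fix f h assume fh: "f \<in> W" "h \<in> W" "T f = T h"
    then have "T (f - h) = (\<lambda>x. 0)"
      by (simp add: T.diff fun_eq_iff)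
    moreover have "f - h \<in> W"
      using fh V.subspace_diff[OF subW] by blast
    ultimately have "f - h = (\<lambda>x. 0)"
      using inj[of "f - h"] unfolding W_def by blast
    then show "f = h"
      by (auto simp: fun_eq_iff)
  qed
  have TW: "T ` W \<subseteq> W"
    using supp by (auto simp: W_def)
  have ind: "V.independent (T ` B)"
    using T.independent_injective_image[OF B(2)] injB B(3) by simp
  have card: "card (T ` B) = card B"
    using card_image inj_on_subset[OF injB B(1)] by blast
  have "W \<subseteq> V.span (T ` B)"
  proof (rule ccontr)
    assume "\<not> W \<subseteq> V.span (T ` B)"
    then obtain h where h: "h \<in> W" "h \<notin> V.span (T ` B)" by blast
    then have "V.independent (insert h (T ` B))" "h \<notin> T ` B"
      using ind V.independent_insertI V.span_base by blast+
    moreover have "insert h (T ` B) \<subseteq> V.span B"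
      using h TW B by blast
    ultimately show False
      using V.independent_span_bound[OF finB] card finB by fastforce
  qed
  also have "V.span (T ` B) = T ` W"
    using T.span_image B(3) by blast
  finally have "W \<subseteq> T ` W" .
  moreover have "g \<in> W"
    using g by (simp add: W_def)
  ultimately obtain f where "f \<in> W" "T f = g"
    by blast
  then show ?thesis
    by (intro that[of f]) (simp_all add: W_def)
qed

lemma E_part_component [simp]: "E_part u n $ j = u n $ Inl j"
  and H_part_component [simp]: "H_part u n $ j = u n $ Inr j"
  by (simp_all add: E_part_def H_part_def)

lemma Mop_add: "Mop (\<lambda>n. v n + w n) n = Mop v n + Mop w n"
  and Mop_scale: "Mop (\<lambda>n. c *s v n) n = c *s Mop v n"
  by (simp_all add: vec_eq_iff forall_3 Mop_def vector_def Ddiff_def algebra_simps)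

lemma Mop_cong_neighbours:
  assumes "\<And>k j. j \<noteq> k \<Longrightarrow> v (n + evec j) $ k = w (n + evec j) $ k"
    and "\<And>k j. j \<noteq> k \<Longrightarrow> v (n - evec j) $ k = w (n - evec j) $ k"
  shows "Mop v n = Mop w n"
  by (simp add: vec_eq_iff forall_3 Mop_def vector_def Ddiff_def assms)

lemma H0_add: "H0 (\<lambda>n. u n + v n) n = H0 u n + H0 v n"
proof -
  have "E_part (\<lambda>n. u n + v n) = (\<lambda>n. E_part u n + E_part v n)"
    "H_part (\<lambda>n. u n + v n) = (\<lambda>n. H_part u n + H_part v n)"
    by (simp_all add: fun_eq_iff vec_eq_iff)
  then have "H0 (\<lambda>n. u n + v n) n $ i = (H0 u n + H0 v n) $ i" for i
    by (cases i) (simp_all add: Mop_add)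
  then show ?thesis by (simp add: vec_eq_iff)
qed

lemma H0_scale: "H0 (\<lambda>n. c *s u n) n = c *s H0 u n"
proof -
  have "E_part (\<lambda>n. c *s u n) = (\<lambda>n. c *s E_part u n)"
    "H_part (\<lambda>n. c *s u n) = (\<lambda>n. c *s H_part u n)"
    by (simp_all add: fun_eq_iff vec_eq_iff)
  then have "H0 (\<lambda>n. c *s u n) n $ i = (c *s H0 u n) $ i" for i
    by (cases i) (simp_all add: Mop_scale)
  then show ?thesis by (simp add: vec_eq_iff)
qed

lemma HD_add: "HD Da (\<lambda>n. u n + v n) n = HD Da u n + HD Da v n"
  by (simp add: HD_def H0_add matrix_vector_right_distrib)

lemma HD_scale: "HD Da (\<lambda>n. c *s u n) n = c *s HD Da u n"
  by (simp add: HD_def H0_scale vec_eq_iff matrix_vector_mult_def sum_distrib_left algebra_simps)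

lemma HD_diff: "HD Da (\<lambda>n. u n - v n) n = HD Da u n - HD Da v n"
  using HD_add[of Da u "\<lambda>n. (- 1) *s v n"] HD_scale[of Da "- 1" v] by (simp add: vector_smult_lneg)

lemma comp_dom_Omega: "n \<in> Omega R \<Longrightarrow> n \<in> comp_dom R j"
  by (simp add: comp_dom_def)

text \<open>The eigenvalues are defined by tangential parts; this restates their definition by exterior values.\<close>

lemma homogeneous_trivial:
  assumes eig: "lam \<notin> eigenvalues R Da" and R: "\<forall>k. R $ k \<ge> 1"
    and eq: "\<And>n. n \<in> Omega R \<Longrightarrow> HD Da u n = lam *s u n"
    and off: "\<And>n. n \<notin> Omega R \<Longrightarrow> u n = 0"
  shows "u = (\<lambda>n. 0)"
proof -
  have "tan_part R w = (\<lambda>n. 0)" if w: "\<And>n. n \<notin> Omega R \<Longrightarrow> w n = 0" for w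
  proof -
    have "tan_part R w = tan_part R (\<lambda>n. 0)"
      by (subst tan_part_eq_iff[OF R]) (auto simp: w comp_dom_def)
    then show ?thesis by (simp add: tan_part_def cdot_def fun_eq_iff)
  qed
  then have "solves R Da lam (\<lambda>n. 0, \<lambda>n. 0) u"
    using eq off by (auto simp: solves_def HOmega_def comp_dom_def vec_eq_iff)
  then show ?thesis using eig by (auto simp: eigenvalues_def)
qed

text \<open>The Dirichlet problem is a square linear system, because the operator that is
  \<open>H\<^sup>D - \<lambda>\<close> at the interior points and the identity on the exterior values acts on the finite-dimensional
  space \<^const>\<open>HOmega\<close>.  Its injectivity is the hypothesis on \<open>lam\<close>.\<close>

lemma Dirichlet_problem_solvable:
  assumes eig: "lam \<notin> eigenvalues R Da" and R: "\<forall>k. R $ k \<ge> 1" and g: "g \<in> HOmega R"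
  obtains v where "v \<in> HOmega R" "\<And>n. n \<in> Omega R \<Longrightarrow> HD Da v n = lam *s v n"
    "\<And>n. n \<notin> Omega R \<Longrightarrow> v n = g n"
proof -
  define idx :: "3 + 3 \<Rightarrow> 3" where "idx i = (case i of Inl j \<Rightarrow> j | Inr j \<Rightarrow> j)" for i
  define I where "I = (SIGMA i : UNIV. comp_dom R (idx i))"
  define fld :: "((3 + 3) \<times> (int ^ 3) \<Rightarrow> complex) \<Rightarrow> int ^ 3 \<Rightarrow> complex ^ (3 + 3)"
    where "fld f n = (\<chi> i. f (i, n))" for f n
  define T where "T f = (\<lambda>(i, n). if n \<in> Omega R then (HD Da (fld f) n - lam *s fld f n) $ i else f (i, n))" for f
  have HOmega_iff: "fld f \<in> HOmega R \<longleftrightarrow> (\<forall>x. x \<notin> I \<longrightarrow> f x = 0)" for f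
    unfolding HOmega_def I_def fld_def idx_def
    by (auto split: sum.splits)
  have fld_add: "fld (\<lambda>x. f x + h x) = (\<lambda>n. fld f n + fld h n)"
    and fld_scale: "fld (\<lambda>x. c * f x) = (\<lambda>n. c *s fld f n)" for f h c
    by (simp_all add: fld_def fun_eq_iff vec_eq_iff)
  obtain f where f: "\<forall>x. x \<notin> I \<longrightarrow> f x = 0"
    "T f = (\<lambda>(i, n). if n \<in> Omega R then 0 else g n $ i)"
  proof (rule injective_on_finite_support_imp_surjective[of I T "\<lambda>(i, n). if n \<in> Omega R then 0 else g n $ i"])
    show "finite I"
      unfolding I_def by (intro finite_SigmaI finite_comp_dom[OF R]) simp
    show "T (\<lambda>x. f x + h x) = (\<lambda>x. T f x + T h x)" for f h
      by (auto simp: T_def fld_add HD_add fun_eq_iff algebra_simps)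
    show "T (\<lambda>x. c * f x) = (\<lambda>x. c * T f x)" for c f
      by (auto simp: T_def fld_scale HD_scale fun_eq_iff algebra_simps)
    show "T f x = 0" if "\<And>y. y \<notin> I \<Longrightarrow> f y = 0" "x \<notin> I" for f x
      using that by (auto simp: T_def I_def comp_dom_Omega split: prod.splits)
    show "f = (\<lambda>x. 0)" if f0: "\<And>y. y \<notin> I \<Longrightarrow> f y = 0" and T0: "T f = (\<lambda>x. 0)" for f
    proof -
      have Tf: "T f (i, n) = 0" for i n using T0 by simp
      have "fld f = (\<lambda>n. 0)"
      proof (rule homogeneous_trivial[OF eig R])
        show "HD Da (fld f) n = lam *s fld f n" if "n \<in> Omega R" for n
          using Tf[of _ n] that by (simp add: T_def vec_eq_iff)
        show "fld f n = 0" if "n \<notin> Omega R" for n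
          using Tf[of _ n] that by (simp add: T_def vec_eq_iff fld_def)
      qed
      then show ?thesis by (auto simp: fld_def fun_eq_iff vec_eq_iff)
    qed
    show "(case x of (i, n) \<Rightarrow> if n \<in> Omega R then 0 else g n $ i) = 0" if "x \<notin> I" for x
    proof (cases x)
      case (Pair i n)
      then have "g n $ i = 0"
        using that g by (cases i) (auto simp: I_def HOmega_def idx_def)
      then show ?thesis by (simp add: Pair)
    qed
  qed
  show ?thesis
  proof (rule that[of "fld f"])
    show "fld f \<in> HOmega R" using f(1) HOmega_iff by blast
    have Tf: "T f (i, n) = (if n \<in> Omega R then 0 else g n $ i)" for i n
      using f(2) by simp
    show "HD Da (fld f) n = lam *s fld f n" if "n \<in> Omega R" for n
      using Tf[of _ n] that by (simp add: T_def vec_eq_iff)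
    show "fld f n = g n" if "n \<notin> Omega R" for n
      using Tf[of _ n] that by (simp add: T_def vec_eq_iff fld_def)
  qed
qed

lemma solves_iff:
  assumes R: "\<forall>k. R $ k \<ge> 1" and u: "u \<in> HOmega R"
  shows "solves R Da lam (tan_part R (E_part u), tan_part R (H_part u)) v \<longleftrightarrow>
    v \<in> HOmega R \<and> (\<forall>n\<in>Omega R. HD Da v n = lam *s v n) \<and> (\<forall>n. n \<notin> Omega R \<longrightarrow> v n = u n)"
proof -
  have sum_all: "(\<forall>i. P i) \<longleftrightarrow> (\<forall>j. P (Inl j)) \<and> (\<forall>j. P (Inr j))" for P :: "3 + 3 \<Rightarrow> bool"
    by (metis sum.exhaust)
  have "tan_part R (E_part v) = tan_part R (E_part u) \<and> tan_part R (H_part v) = tan_part R (H_part u)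
      \<longleftrightarrow> (\<forall>n. n \<notin> Omega R \<longrightarrow> v n = u n)" if v: "v \<in> HOmega R"
  proof -
    have "tan_part R (E_part v) = tan_part R (E_part u) \<longleftrightarrow> (\<forall>n. n \<notin> Omega R \<longrightarrow> E_part v n = E_part u n)"
      "tan_part R (H_part v) = tan_part R (H_part u) \<longleftrightarrow> (\<forall>n. n \<notin> Omega R \<longrightarrow> H_part v n = H_part u n)"
      using u v by (intro tan_part_eq_iff[OF R]; simp add: HOmega_def)+
    then show ?thesis by (auto simp: vec_eq_iff sum_all)
  qed
  then show ?thesis by (auto simp: solves_def)
qed

text \<open>The definite description in \<^const>\<open>DtN\<close> denotes the solution, as two solutions differ by a solution
  of the homogeneous problem.\<close>

lemma DtN_solution:
  assumes R: "\<forall>k. R $ k \<ge> 1" and eig: "lam \<notin> eigenvalues R Da"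
    and u: "u \<in> HOmega R" and eq: "\<And>n. n \<in> Omega R \<Longrightarrow> HD Da u n = lam *s u n"
  shows "DtN R Da lam (tan_part R (E_part u), tan_part R (H_part u))
    = (tan_deriv R (E_part u), tan_deriv R (H_part u))"
proof -
  have "(THE v. solves R Da lam (tan_part R (E_part u), tan_part R (H_part u)) v) = u"
  proof (rule the_equality)
    show "solves R Da lam (tan_part R (E_part u), tan_part R (H_part u)) u"
      using u eq by (subst solves_iff[OF R u]) simp
  next
    fix v assume "solves R Da lam (tan_part R (E_part u), tan_part R (H_part u)) v"
    then have v: "\<And>n. n \<in> Omega R \<Longrightarrow> HD Da v n = lam *s v n" "\<And>n. n \<notin> Omega R \<Longrightarrow> v n = u n"
      by (simp_all add: solves_iff[OF R u])
    have "(\<lambda>n. v n - u n) = (\<lambda>n. 0)"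
      by (rule homogeneous_trivial[OF eig R]) (simp_all add: HD_diff v eq vector_ssub_ldistrib)
    then show "v = u" by (auto simp: fun_eq_iff)
  qed
  then show ?thesis
    using tan_part_Hadm[OF R] by (simp add: DtN_def)
qed

section \<open>Green's identity and the orthogonality relation\<close>

lemma sum_shift_support:
  fixes d w :: "int ^ 3 \<Rightarrow> complex"
  assumes fin: "finite A" and supp: "\<And>n. d n \<noteq> 0 \<Longrightarrow> n \<in> A \<and> n - e \<in> A"
  shows "(\<Sum>n\<in>A. d (n + e) * w n) = (\<Sum>n\<in>A. d n * w (n - e))"
proof -
  let ?S = "{n \<in> A. d n \<noteq> 0}"
  have "(\<Sum>n\<in>A. d (n + e) * w n) = (\<Sum>n\<in>(\<lambda>n. n - e) ` ?S. d (n + e) * w n)"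
  proof (rule sum.mono_neutral_right[OF fin])
    show "(\<lambda>n. n - e) ` ?S \<subseteq> A" using supp by auto
    show "\<forall>n\<in>A - (\<lambda>n. n - e) ` ?S. d (n + e) * w n = 0"
    proof
      fix n assume n: "n \<in> A - (\<lambda>n. n - e) ` ?S"
      have "d (n + e) = 0"
      proof (rule ccontr)
        assume "d (n + e) \<noteq> 0"
        then have "n + e \<in> ?S" using supp by blast
        then have "(n + e) - e \<in> (\<lambda>n. n - e) ` ?S" by blast
        then show False using n by simp
      qed
      then show "d (n + e) * w n = 0" by simp
    qed
  qed
  also have "\<dots> = (\<Sum>n\<in>?S. d n * w (n - e))"
    by (subst sum.reindex) (auto simp: inj_on_def)
  also have "\<dots> = (\<Sum>n\<in>A. d n * w (n - e))"
    by (rule sum.mono_neutral_left[OF fin]) auto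
  finally show ?thesis .
qed

lemma sum_Ddiff_by_parts:
  fixes d w :: "int ^ 3 \<Rightarrow> complex"
  assumes fin: "finite A"
    and supp: "\<And>n. d n \<noteq> 0 \<Longrightarrow> n \<in> A \<and> n - evec j \<in> A \<and> n + evec j \<in> A"
  shows "(\<Sum>n\<in>A. Ddiff j d n * w n) = - (\<Sum>n\<in>A. d n * Ddiff j w n)"
proof -
  have "(\<Sum>n\<in>A. d (n + evec j) * w n) = (\<Sum>n\<in>A. d n * w (n - evec j))"
    using supp by (intro sum_shift_support[OF fin]) auto
  moreover have "(\<Sum>n\<in>A. d (n + - evec j) * w n) = (\<Sum>n\<in>A. d n * w (n - - evec j))"
    using supp by (intro sum_shift_support[OF fin]) auto
  ultimately show ?thesis
    by (simp add: Ddiff_def algebra_simps sum_subtractf sum_negf)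
qed

text \<open>Summation by parts makes each difference operator skew, and the curl is skew in its components as
  well; the two signs cancel.  The support of \<open>d\<close> removes the boundary terms.\<close>

lemma sum_Mop_symmetric:
  assumes fin: "finite A"
    and supp: "\<And>n i j. d n $ i \<noteq> 0 \<Longrightarrow> j \<noteq> i \<Longrightarrow> n \<in> A \<and> n - evec j \<in> A \<and> n + evec j \<in> A"
  shows "(\<Sum>n\<in>A. \<Sum>i\<in>UNIV. Mop d n $ i * w n $ i) = (\<Sum>n\<in>A. \<Sum>i\<in>UNIV. d n $ i * Mop w n $ i)"
proof -
  have part: "(\<Sum>n\<in>A. Ddiff j (\<lambda>x. d x $ i) n * w n $ k) = - (\<Sum>n\<in>A. d n $ i * Ddiff j (\<lambda>x. w x $ k) n)"
    if "j \<noteq> i" for i j k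
    using sum_Ddiff_by_parts[OF fin, of "\<lambda>x. d x $ i" j "\<lambda>x. w x $ k"] supp that by blast
  define c :: complex where "c = inverse (2 * \<i>)"
  note Mop_c = Mop_def[folded c_def]
  have "(\<Sum>n\<in>A. \<Sum>i\<in>UNIV. Mop d n $ i * w n $ i) = c *
     (- (\<Sum>n\<in>A. Ddiff 3 (\<lambda>x. d x $ 2) n * w n $ 1) + (\<Sum>n\<in>A. Ddiff 2 (\<lambda>x. d x $ 3) n * w n $ 1)
      + (\<Sum>n\<in>A. Ddiff 3 (\<lambda>x. d x $ 1) n * w n $ 2) - (\<Sum>n\<in>A. Ddiff 1 (\<lambda>x. d x $ 3) n * w n $ 2)
      - (\<Sum>n\<in>A. Ddiff 2 (\<lambda>x. d x $ 1) n * w n $ 3) + (\<Sum>n\<in>A. Ddiff 1 (\<lambda>x. d x $ 2) n * w n $ 3))"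
    by (simp add: sum_3 Mop_c vector_def sum.distrib sum_subtractf sum_negf sum_distrib_left algebra_simps)
  also have "\<dots> = (\<Sum>n\<in>A. \<Sum>i\<in>UNIV. d n $ i * Mop w n $ i)"
    by (simp add: part) (simp add: sum_3 Mop_c vector_def sum.distrib sum_subtractf sum_negf sum_distrib_left algebra_simps)
  finally show ?thesis .
qed

lemma sum_UNIV_sum:
  fixes f :: "'a::finite + 'b::finite \<Rightarrow> 'c::comm_monoid_add"
  shows "(\<Sum>i\<in>UNIV. f i) = (\<Sum>j\<in>UNIV. f (Inl j)) + (\<Sum>j\<in>UNIV. f (Inr j))"
  by (simp flip: UNIV_Plus_UNIV add: sum.Plus comp_def)

text \<open>The operator \<^const>\<open>H0\<close> is symmetric for the bilinear form with opposite signs on the electric and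
  the magnetic components, because the discrete curl is symmetric and occurs in \<^const>\<open>H0\<close> with both signs.\<close>

definition em_sign :: "3 + 3 \<Rightarrow> complex" where
  "em_sign i = (case i of Inl j \<Rightarrow> 1 | Inr j \<Rightarrow> - 1)"

lemma sum_H0_symmetric:
  assumes fin: "finite A"
    and E: "\<And>n i j. d n $ Inl i \<noteq> 0 \<Longrightarrow> j \<noteq> i \<Longrightarrow> n \<in> A \<and> n - evec j \<in> A \<and> n + evec j \<in> A"
    and H: "\<And>n i j. d n $ Inr i \<noteq> 0 \<Longrightarrow> j \<noteq> i \<Longrightarrow> n \<in> A \<and> n - evec j \<in> A \<and> n + evec j \<in> A"
  shows "(\<Sum>n\<in>A. \<Sum>i\<in>UNIV. em_sign i * (H0 d n $ i * w n $ i))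
    = (\<Sum>n\<in>A. \<Sum>i\<in>UNIV. em_sign i * (d n $ i * H0 w n $ i))"
proof -
  have "(\<Sum>n\<in>A. \<Sum>i\<in>UNIV. em_sign i * (H0 d n $ i * w n $ i))
     = (\<Sum>n\<in>A. \<Sum>j\<in>UNIV. Mop (H_part d) n $ j * E_part w n $ j)
       + (\<Sum>n\<in>A. \<Sum>j\<in>UNIV. Mop (E_part d) n $ j * H_part w n $ j)"
    by (simp add: sum_UNIV_sum em_sign_def sum.distrib)
  also have "\<dots> = (\<Sum>n\<in>A. \<Sum>j\<in>UNIV. H_part d n $ j * Mop (E_part w) n $ j)
       + (\<Sum>n\<in>A. \<Sum>j\<in>UNIV. E_part d n $ j * Mop (H_part w) n $ j)"
    using E H by (intro arg_cong2[of _ _ _ _ "(+)"] sum_Mop_symmetric[OF fin]; simp)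
  also have "\<dots> = (\<Sum>n\<in>A. \<Sum>i\<in>UNIV. em_sign i * (d n $ i * H0 w n $ i))"
    by (simp add: sum_UNIV_sum em_sign_def sum.distrib)
  finally show ?thesis .
qed

lemma neighbour_cases:
  assumes "n \<in> Omega R"
  shows "n + evec k \<in> Omega R \<or> n + evec k \<in> bdry_plus R k"
    and "n - evec k \<in> Omega R \<or> n - evec k \<in> bdry_minus R k"
  using assms by (auto simp: Omega_def bdry_plus_def bdry_minus_def evec_component)
    (smt (verit))+

text \<open>The support condition of Green's identity for a difference of fields with the same Cauchy
  data: along every axis \<open>j \<noteq> i\<close> the \<open>i\<close>-th component is tangential to the faces, hence the
  difference vanishes both at the face and at the layer next to it.\<close>

lemma same_Cauchy_data_support:
  assumes R: "\<forall>k. R $ k \<ge> 1"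
    and v: "\<And>n j. n \<notin> comp_dom R j \<Longrightarrow> v n $ j = 0"
    and w: "\<And>n j. n \<notin> comp_dom R j \<Longrightarrow> w n $ j = 0"
    and eq: "tan_part R v = tan_part R w" "tan_deriv R v = tan_deriv R w"
    and ne: "v n $ i \<noteq> w n $ i" and ji: "j \<noteq> i"
  shows "n \<in> Omega R \<and> n - evec j \<in> Omega R \<and> n + evec j \<in> Omega R"
proof -
  have n: "n \<in> Omega R"
  proof (rule ccontr)
    have "\<forall>n. n \<notin> Omega R \<longrightarrow> v n = w n"
      using tan_part_eq_iff[of R v w] R v w eq(1) by simp
    moreover assume "n \<notin> Omega R"
    ultimately show False using ne by simp
  qed
  have same: "v (m_Omega R x) $ i = w (m_Omega R x) $ i" if "x \<in> bdry_dir R j" for x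
    using tan_deriv_eq_imp[OF R that, of v w i] eq ji by simp
  have "n + evec j \<notin> bdry_plus R j"
    using same[of "n + evec j"] ne m_Omega_plus[OF R, of "n + evec j" j] by (auto simp: bdry_dir_def)
  moreover have "n - evec j \<notin> bdry_minus R j"
    using same[of "n - evec j"] ne m_Omega_minus[OF R, of "n - evec j" j] by (auto simp: bdry_dir_def)
  ultimately show ?thesis using n neighbour_cases[OF n, of j] by blast
qed

text \<open>Let \<open>v\<close> solve the second equation in the box with the tangential boundary values of \<open>u\<close>.  As the
  Dirichlet-to-Neumann operators agree, \<open>u - v\<close> has zero Cauchy data and Green's identity for
  \<open>u - v\<close> and \<open>w\<close> has no boundary terms.  The terms with \<open>v\<close> cancel because \<open>v\<close> and \<open>w\<close> see the same
  medium, and only the difference of the media tested against \<open>u w\<close> is left.\<close>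

lemma DtN_orthogonality:
  assumes R: "\<forall>k. R $ k \<ge> 1" and lam: "lam \<noteq> 0"
    and pos: "\<And>n. pos_diagonal (Da n)" and pos': "\<And>n. pos_diagonal (Da' n)"
    and eig: "lam \<notin> eigenvalues R Da" and eig': "lam \<notin> eigenvalues R Da'"
    and DtN: "DtN R Da lam = DtN R Da' lam"
    and u: "\<And>n. HD Da u n = lam *s u n" and w: "\<And>n. HD Da' w n = lam *s w n"
  shows "(\<Sum>n\<in>Omega R. \<Sum>i\<in>UNIV. em_sign i *
      ((1 / of_real (Da n $ i $ i) - 1 / of_real (Da' n $ i $ i)) * u n $ i * w n $ i)) = 0"
proof -
  \<comment> \<open>The truncation of \<open>u\<close> belongs to \<^const>\<open>HOmega\<close>, and the equations in the box do not see the
    values that it removes.\<close>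
  define u' :: "int ^ 3 \<Rightarrow> complex ^ (3 + 3)" where
    "u' n = (\<chi> i. if n \<in> comp_dom R (case i of Inl j \<Rightarrow> j | Inr j \<Rightarrow> j) then u n $ i else 0)" for n
  have u'H: "u' \<in> HOmega R" by (simp add: HOmega_def u'_def)
  have u'_in: "u' n = u n" if "n \<in> Omega R" for n
    using that by (simp add: u'_def vec_eq_iff comp_dom_Omega)
  have near: "n + evec j \<in> comp_dom R k" "n - evec j \<in> comp_dom R k" if "n \<in> Omega R" "j \<noteq> k" for n j k
    using neighbour_cases[OF that(1), of j] that(2) by (auto simp: comp_dom_def bdry_dir_def)
  have "H0 u' n = H0 u n" if "n \<in> Omega R" for n
  proof -
    have "Mop (E_part u') n = Mop (E_part u) n" "Mop (H_part u') n = Mop (H_part u) n"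
      using near[OF that] by (intro Mop_cong_neighbours; simp add: u'_def)+
    then show ?thesis by (simp add: H0_def)
  qed
  then have u'_eq: "HD Da u' n = lam *s u' n" if "n \<in> Omega R" for n
    using u[of n] that by (simp add: HD_def u'_in)
  obtain v where v: "v \<in> HOmega R" "\<And>n. n \<in> Omega R \<Longrightarrow> HD Da' v n = lam *s v n"
    "\<And>n. n \<notin> Omega R \<Longrightarrow> v n = u' n"
    using Dirichlet_problem_solvable[OF eig' R u'H] by blast
  have vE: "\<And>n j. n \<notin> comp_dom R j \<Longrightarrow> E_part v n $ j = 0" "\<And>n j. n \<notin> comp_dom R j \<Longrightarrow> H_part v n $ j = 0"
    and uE: "\<And>n j. n \<notin> comp_dom R j \<Longrightarrow> E_part u' n $ j = 0" "\<And>n j. n \<notin> comp_dom R j \<Longrightarrow> H_part u' n $ j = 0"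
    using v(1) u'H by (auto simp: HOmega_def)
  have tan: "tan_part R (E_part u') = tan_part R (E_part v)" "tan_part R (H_part u') = tan_part R (H_part v)"
    using v(3) by (auto simp: tan_part_eq_iff[OF R uE(1) vE(1)] tan_part_eq_iff[OF R uE(2) vE(2)] vec_eq_iff)
  have "(tan_deriv R (E_part u'), tan_deriv R (H_part u')) = (tan_deriv R (E_part v), tan_deriv R (H_part v))"
    using DtN_solution[OF R eig u'H u'_eq] DtN_solution[OF R eig' v(1,2)] DtN tan by simp
  then have deriv: "tan_deriv R (E_part u') = tan_deriv R (E_part v)"
    "tan_deriv R (H_part u') = tan_deriv R (H_part v)" by simp_all
  define d where "d n = u' n - v n" for n
  have green: "(\<Sum>n\<in>Omega R. \<Sum>i\<in>UNIV. em_sign i * (H0 d n $ i * w n $ i))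
    = (\<Sum>n\<in>Omega R. \<Sum>i\<in>UNIV. em_sign i * (d n $ i * H0 w n $ i))"
  proof (rule sum_H0_symmetric[OF finite_Omega])
    show "n \<in> Omega R \<and> n - evec j \<in> Omega R \<and> n + evec j \<in> Omega R"
      if "d n $ Inl i \<noteq> 0" "j \<noteq> i" for n i j
      using same_Cauchy_data_support[OF R uE(1) vE(1) tan(1) deriv(1), of n i j] that by (simp add: d_def)
    show "n \<in> Omega R \<and> n - evec j \<in> Omega R \<and> n + evec j \<in> Omega R"
      if "d n $ Inr i \<noteq> 0" "j \<noteq> i" for n i j
      using same_Cauchy_data_support[OF R uE(2) vE(2) tan(2) deriv(2), of n i j] that by (simp add: d_def)
  qed
  have H0_solution: "H0 x n $ i = lam * (1 / of_real (D n $ i $ i)) * x n $ i"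
    if "pos_diagonal (D n)" "HD D x n = lam *s x n" for D x n i
  proof -
    have "of_real (D n $ i $ i) * H0 x n $ i = lam * x n $ i"
      using HD_component[of D n x i] that by simp
    moreover have "D n $ i $ i \<noteq> 0"
      using that(1) by (simp add: pos_diagonal_def) (metis less_irrefl)
    ultimately show ?thesis by (simp add: field_simps)
  qed
  have H0d: "H0 d n = H0 u' n - H0 v n" for n
    using H0_add[of u' "\<lambda>n. (- 1) *s v n" n] H0_scale[of "- 1" v n] by (simp add: d_def[abs_def] vector_smult_lneg)
  have "0 = (\<Sum>n\<in>Omega R. \<Sum>i\<in>UNIV. em_sign i * (H0 d n $ i * w n $ i))
    - (\<Sum>n\<in>Omega R. \<Sum>i\<in>UNIV. em_sign i * (d n $ i * H0 w n $ i))"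
    using green by simp
  also have "\<dots> = (\<Sum>n\<in>Omega R. \<Sum>i\<in>UNIV. em_sign i * (H0 d n $ i * w n $ i - d n $ i * H0 w n $ i))"
    by (simp add: sum_subtractf right_diff_distrib)
  also have "\<dots> = (\<Sum>n\<in>Omega R. \<Sum>i\<in>UNIV. lam * (em_sign i *
      ((1 / of_real (Da n $ i $ i) - 1 / of_real (Da' n $ i $ i)) * u n $ i * w n $ i)))"
  proof (intro sum.cong refl)
    fix n i assume n: "n \<in> Omega R"
    show "em_sign i * (H0 d n $ i * w n $ i - d n $ i * H0 w n $ i) = lam * (em_sign i *
      ((1 / of_real (Da n $ i $ i) - 1 / of_real (Da' n $ i $ i)) * u n $ i * w n $ i))"
      using H0_solution[OF pos u'_eq[OF n], of i] H0_solution[OF pos' v(2)[OF n], of i]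
        H0_solution[OF pos' w, of n i]
      by (simp add: H0d d_def u'_in[OF n] diff_divide_distrib algebra_simps)
  qed
  also have "\<dots> = lam * (\<Sum>n\<in>Omega R. \<Sum>i\<in>UNIV. em_sign i *
      ((1 / of_real (Da n $ i $ i) - 1 / of_real (Da' n $ i $ i)) * u n $ i * w n $ i))"
    by (simp add: sum_distrib_left)
  finally show ?thesis using lam by simp
qed

section \<open>Uniqueness of the medium\<close>

theorem theorem1p1:
  fixes R :: "int ^ 3"
    and lam :: complex
    and eps0 mu0 :: "real ^ 3 ^ 3"
    and Da Da' :: "int ^ 3 \<Rightarrow> real ^ (3 + 3) ^ (3 + 3)"
  assumes "\<forall>k. R $ k \<ge> 1"
    and "lam \<noteq> 0"
    and "anisotropy R eps0 mu0 Da"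
    and "anisotropy R eps0 mu0 Da'"
    and "lam \<notin> eigenvalues R Da \<union> eigenvalues R Da'"
    and "DtN R Da lam = DtN R Da' lam"
  shows "Da = Da'"
proof -
  note R = assms(1) and lam = assms(2) and DtN = assms(6)
  have eig: "lam \<notin> eigenvalues R Da" "lam \<notin> eigenvalues R Da'"
    using assms(5) by auto
  have pos: "pos_diagonal (Da n)" "pos_diagonal (Da' n)" for n
    using assms(3,4) by (auto simp: anisotropy_def)
  have outside: "Da n = Da' n" if "n \<notin> Omega R" for n
    using assms(3,4) that by (simp add: anisotropy_def)
  have diag: "Da n $ i $ i = Da' n $ i $ i" if "n \<in> Omega R" for n i
    using that
  proof (induction "nat (n $ 3)" arbitrary: n i rule: less_induct)
    case (less n0 i0)
    define j0 where "j0 = (case i0 of Inl j \<Rightarrow> j | Inr j \<Rightarrow> j)"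
    \<comment> \<open>The march along axis 1 reaches the components 1 and 3, the one along axis 2 the component 2.\<close>
    obtain a b and s :: complex where ori: "oriented a b 3 s" and j0: "j0 = a \<or> j0 = 3"
    proof (cases "j0 = 2")
      case True
      then show ?thesis by (intro that[of 2 1 "- 1"]) (simp_all add: oriented_def)
    next
      case False
      then show ?thesis using exhaust_3[of j0]
        by (intro that[of 1 2 1]) (auto simp: oriented_def)
    qed
    have i0: "i0 = Inl j0 \<or> i0 = Inr j0" by (auto simp: j0_def split: sum.splits)
    have t: "(1::int) = 1 \<or> (1::int) = - 1" "(- 1::int) = 1 \<or> (- 1::int) = - 1"
      by simp_all
    obtain u where "\<forall>n. HD Da u n = lam *s u n"
      "\<forall>n i. n0 $ 3 \<le> n $ 3 \<longrightarrow> u n $ i \<noteq> 0 \<longrightarrow> n $ 3 - n0 $ 3 \<le> 1 * (n $ a - n0 $ a)"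
      "\<forall>n i. n $ 3 = n0 $ 3 \<longrightarrow> n $ a = n0 $ a \<longrightarrow> (u n $ i \<noteq> 0 \<longleftrightarrow> n = n0 \<and> i = i0)"
      by (rule cone_solution[where Da = Da and ?n0.0 = n0, OF ori lam pos(1) t(1) j0 i0])
    note u = this[rule_format]
    obtain w where "\<forall>n. HD Da' w n = lam *s w n"
      "\<forall>n i. n0 $ 3 \<le> n $ 3 \<longrightarrow> w n $ i \<noteq> 0 \<longrightarrow> n $ 3 - n0 $ 3 \<le> - 1 * (n $ a - n0 $ a)"
      "\<forall>n i. n $ 3 = n0 $ 3 \<longrightarrow> n $ a = n0 $ a \<longrightarrow> (w n $ i \<noteq> 0 \<longleftrightarrow> n = n0 \<and> i = i0)"
      by (rule cone_solution[where Da = Da' and ?n0.0 = n0, OF ori lam pos(2) t(2) j0 i0])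
    note w = this[rule_format]
    define q where "q n i = em_sign i *
      ((1 / of_real (Da n $ i $ i) - 1 / of_real (Da' n $ i $ i)) * u n $ i * w n $ i)" for n i
    \<comment> \<open>Below \<open>n0\<close> the media agree by induction; above, the two cones open in opposite directions and
      meet only in the edge through \<open>n0\<close>.\<close>
    have single: "q n i = 0" if n: "n \<in> Omega R" and ne: "n \<noteq> n0 \<or> i \<noteq> i0" for n i
    proof (cases "n $ 3 < n0 $ 3")
      case True
      have "n $ 3 \<ge> 1" using n by (simp add: Omega_def)
      then have "Da n $ i $ i = Da' n $ i $ i"
        using True n by (intro less.hyps) auto
      then show ?thesis by (simp add: q_def)
    next
      case False
      have "u n $ i = 0 \<or> w n $ i = 0"
      proof (rule ccontr)
        assume nz: "\<not> (u n $ i = 0 \<or> w n $ i = 0)"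
        then have "n $ 3 - n0 $ 3 \<le> n $ a - n0 $ a" "n $ 3 - n0 $ 3 \<le> - (n $ a - n0 $ a)"
          using u(2)[of n i] w(2)[of n i] False by auto
        then have "n $ 3 = n0 $ 3" "n $ a = n0 $ a" using False by auto
        then show False using u(3)[of n i] nz ne by simp
      qed
      then show ?thesis by (auto simp: q_def)
    qed
    have "0 = (\<Sum>n\<in>Omega R. \<Sum>i\<in>UNIV. q n i)"
      unfolding q_def using DtN_orthogonality[OF R lam pos eig DtN u(1) w(1)] by simp
    also have "\<dots> = (\<Sum>n\<in>Omega R. if n = n0 then q n0 i0 else 0)"
    proof (rule sum.cong[OF refl])
      fix n assume n: "n \<in> Omega R"
      have "(\<Sum>i\<in>UNIV. q n i) = (\<Sum>i\<in>UNIV. if i = i0 then q n i0 else 0)"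
        using single[OF n] by (intro sum.cong refl) (simp split: if_split)
      then show "(\<Sum>i\<in>UNIV. q n i) = (if n = n0 then q n0 i0 else 0)"
        using single[OF n] by auto
    qed
    also have "\<dots> = q n0 i0"
      using less.prems finite_Omega by simp
    finally have "q n0 i0 = 0" by simp
    moreover have "u n0 $ i0 \<noteq> 0" "w n0 $ i0 \<noteq> 0"
      using u(3)[of n0 i0] w(3)[of n0 i0] by auto
    moreover have "em_sign i0 \<noteq> 0" by (simp add: em_sign_def split: sum.splits)
    ultimately have "1 / complex_of_real (Da n0 $ i0 $ i0) = 1 / complex_of_real (Da' n0 $ i0 $ i0)"
      by (simp add: q_def)
    then show ?case by (simp add: field_simps)
  qed
  show ?thesis
  proof
    fix n
    show "Da n = Da' n"
    proof (cases "n \<in> Omega R")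
      case True
      have "Da n $ i $ j = Da' n $ i $ j" for i j
        using pos[of n] diag[OF True] by (cases "i = j") (simp_all add: pos_diagonal_def)
      then show ?thesis by (simp add: vec_eq_iff)
    qed (rule outside)
  qed
qed

end
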